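(* Let $\kappa^-<\kappa^+$ and let $\rho^-,\rho^+$ satisfy $$0<\rho^-<\hat\rho<\rho^+<1,\qquad f(\kappa^-,\rho^-)=f(\kappa^+,\rho^+)=:\bar f .$$ Then there exist infinitely many functions $P:\mathbb{R}\to[0,1]$ satisfying $$P(x)\int_x^{x+h}\kappa(y)\,v(P(y))\,w(y-x)\,dy=\bar f\qquad\text{for all } x\in\mathbb{R}$$ and the boundary conditions $$\lim_{x\to-\infty}P(x)=\rho^-,\qquad\lim_{x\to+\infty}P(x)=\rho^+ .$$
   Context: Fix $h>0$ and $\kappa^-,\kappa^+>0$, and let $\kappa(x)=\kappa^-$ for $x<0$ and $\kappa(x)=\kappa^+$ for $x>0$. The function $v\in C^2$ satisfies $v(0)=1$, $v(1)=0$, $v'(\rho)<0$ and $v''(\rho)\le 0$ for all $\rho\in[0,1]$. The weight $w\ge 0$ is defined on $x\ge0$, is continuous and bounded on $x>0$, and satisfies $\int_0^h w(x)\,dx=1$, $w(x)=0$ for all $x\ge h$, and $w'(x)<0$ for all $x\in(0,h)$. Put $f(\kappa,\rho)=\kappa\,\rho\,v(\rho)$. The number $\hat\rho\in(0,1)$ is the unique point (independent of $\kappa>0$) with $f_\rho(\kappa,\hat\rho)=0$, $f_\rho(\kappa,\rho)>0$ for $\rho<\hat\rho$ and $f_\rho(\kappa,\rho)<0$ for $\rho>\hat\rho$. Such a $P$ is a stationary solution of the nonlocal conservation law $\rho_t+[\rho(t,x)\int_x^{x+h}\kappa(y)v(\rho(t,y))w(y-x)\,dy]_x=0$. *)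

theory Defs
  imports "HOL-Analysis.Analysis"
begin

definition flux :: "(real \<Rightarrow> real) \<Rightarrow> real \<Rightarrow> real \<Rightarrow> real" where
  "flux v k \<rho> = k * \<rho> * v \<rho>"

(* Derivatives are taken within [0,1], since v need only be C^2 on [0,1] (one-sided at
   the end points). *)
definition critical_density :: "(real \<Rightarrow> real) \<Rightarrow> real \<Rightarrow> bool" where
  "critical_density v \<rho>hat \<longleftrightarrow>
     0 < \<rho>hat \<and> \<rho>hat < 1 \<and>
     (\<forall>k>0. \<exists>f'.
        (\<forall>\<rho>\<in>{0..1}. (flux v k has_real_derivative f' \<rho>) (at \<rho> within {0..1})) \<and>
        f' \<rho>hat = 0 \<and>
        (\<forall>\<rho>\<in>{0..<\<rho>hat}. f' \<rho> > 0) \<and>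
        (\<forall>\<rho>\<in>{\<rho>hat<..1}. f' \<rho> < 0))"

(* Integrability is demanded explicitly because the Lebesgue integral of a non-integrable
   function is 0 by convention. *)
definition stationary_profile ::
  "real \<Rightarrow> (real \<Rightarrow> real) \<Rightarrow> (real \<Rightarrow> real) \<Rightarrow> (real \<Rightarrow> real) \<Rightarrow> real \<Rightarrow> (real \<Rightarrow> real) \<Rightarrow> bool" where
  "stationary_profile h \<kappa> v w fbar P \<longleftrightarrow>
     (\<forall>x. P x \<in> {0..1}) \<and>
     (\<forall>x. set_integrable lebesgue {x..x+h} (\<lambda>y. \<kappa> y * v (P y) * w (y - x)) \<and>
          P x * (LINT y:{x..x+h}|lebesgue. \<kappa> y * v (P y) * w (y - x)) = fbar)"

end

theory Submission
  imports Defs "HOL-Probability.Probability_Measure"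
begin

text \<open>
  A profile with flux \<open>F\<close> is a fixed point of \<open>T P x = F / \<integral> \<kappa> (x + y) v (P (x + y)) w y dy\<close>.
  Since \<open>v\<close> is decreasing, \<open>T\<close> is monotone, and it commutes with bounded pointwise limits.
  Hence iteration started at a subsolution that lies below a supersolution climbs to a
  solution between the two (\<open>monotone_iteration\<close>). Everything else is the construction of
  barriers, where a barrier may jump: only the pointwise inequality counts.

  On the homogeneous road \<open>\<kappa> = \<kappa>p\<close> the constant \<open>\<rho>p\<close> is a solution. Linearised about it the
  equation reads \<open>u x = c \<integral> u (x + y) w y dy\<close> with \<open>c = - \<rho>p v' \<rho>p / v \<rho>p\<close>, and \<open>c > 1\<close> because the
  flux decreases at \<open>\<rho>p > \<rho>hat\<close>. So some \<open>e x = exp (- \<mu> x)\<close> with \<open>\<mu> > 0\<close> solves the linearised equation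
  (\<open>decay_rate_exists\<close>). As \<open>v\<close> is concave, \<open>max 0 (\<rho>p - e)\<close> is a subsolution of the nonlinear one, and
  since its second derivative is bounded below, \<open>\<rho>p - max 0 (e - K e\<^sup>2)\<close> is a supersolution
  for large \<open>K\<close>. Between them there is a nonconstant nondecreasing solution \<open>P0\<close> that tends to \<open>\<rho>p\<close>
  (\<open>homogeneous_transition\<close>). Its limit at minus infinity cannot lie in \<open>[\<rho>m, \<rho>p)\<close>, where the flux
  \<open>\<kappa>p r v r\<close> exceeds the prescribed one; so \<open>P0\<close> drops below \<open>\<rho>m\<close> (\<open>transition_descends\<close>).

  Translate \<open>P0\<close> to the right by \<open>s\<close>, so far that it is at most \<open>\<rho>m\<close> on all of \<open>x \<le> h\<close>. Then
  replacing it by the constant \<open>\<rho>m\<close> on \<open>x < 0\<close> gives a supersolution for the road with a jump,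
  and the maximum of the translate and \<open>\<rho>m - A exp (\<nu> x)\<close> is a subsolution, where \<open>\<nu> > 0\<close> is
  available because the flux increases at \<open>\<rho>m < \<rho>hat\<close>. The solution \<open>P\<^sub>s\<close> in between
  (\<open>interface_profile\<close>) tends to \<open>\<rho>m\<close> on the left and coincides with the translate of
  \<open>P0\<close> on \<open>x \<ge> 0\<close>. Different \<open>s\<close> give different profiles, since otherwise \<open>P0\<close> would be
  periodic near plus infinity although it tends to \<open>\<rho>p\<close> from strictly below
  (\<open>translates_distinct\<close>). So the admissible shifts \<open>s\<close> already supply infinitely many profiles.
\<close>

section \<open>Averages over the road ahead\<close>

text \<open>The weight enters only through the probability measure \<open>M\<close> that it defines on \<open>(0, h)\<close>.
The velocity is assumed to be defined on the whole line, with values in \<open>[0, 1]\<close>; a velocity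
on \<open>[0, 1]\<close> is extended by constants, so that compositions are always bounded and measurable.\<close>

locale look_ahead = prob_space M for M :: "real measure" +
  fixes h :: real and v :: "real \<Rightarrow> real"
  assumes h_pos: "0 < h"
    and sets_M [measurable_cong]: "sets M = sets borel"
    and supp_M: "AE y in M. 0 < y \<and> y < h"
    and v_cont: "continuous_on UNIV v"
    and v_anti: "antimono v"
    and v_nonneg: "\<And>r. 0 \<le> v r"
    and v_le_1: "\<And>r. v r \<le> 1"
begin

definition avg :: "(real \<Rightarrow> real) \<Rightarrow> real \<Rightarrow> real" where
  "avg g x = (\<integral>y. g (x + y) \<partial>M)"

lemma v_measurable [measurable]: "v \<in> borel_measurable borel"
  using v_cont by (rule borel_measurable_continuous_onI)

lemma v_antiD: "r \<le> s \<Longrightarrow> v s \<le> v r"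
  using v_anti by (auto simp: antimono_def)

lemma avg_measurable [measurable]:
  assumes [measurable]: "g \<in> borel_measurable borel"
  shows "avg g \<in> borel_measurable borel"
  unfolding avg_def by measurable

lemma integrable_shift:
  fixes g :: "real \<Rightarrow> real"
  assumes [measurable]: "g \<in> borel_measurable borel"
    and "AE y in M. \<bar>g (x + y)\<bar> \<le> C"
  shows "integrable M (\<lambda>y. g (x + y))"
  by (rule integrable_const_bound[where B = C]) (use assms(2) in \<open>auto\<close>)

lemma avg_mono:
  assumes "integrable M (\<lambda>y. f (x + y))" "integrable M (\<lambda>y. g (x' + y))"
    and "\<And>y. 0 < y \<Longrightarrow> y < h \<Longrightarrow> f (x + y) \<le> g (x' + y)"
  shows "avg f x \<le> avg g x'"
  unfolding avg_def
  by (rule integral_mono_AE[OF assms(1,2)]) (use supp_M assms(3) in \<open>auto elim: eventually_mono\<close>)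

lemma avg_const: "avg (\<lambda>_. c) x = c"
  by (simp add: avg_def prob_space)

lemma integrable_flow:
  assumes [measurable]: "\<kappa> \<in> borel_measurable borel" "P \<in> borel_measurable borel"
    and "\<And>z. 0 \<le> \<kappa> z" "\<And>z. \<kappa> z \<le> k"
  shows "integrable M (\<lambda>y. \<kappa> (x + y) * v (P (x + y)))"
proof (rule integrable_shift[where g = "\<lambda>z. \<kappa> z * v (P z)" and C = k])
  have "\<bar>\<kappa> z * v (P z)\<bar> \<le> k" for z
    using mult_mono[OF assms(4)[of z] v_le_1[of "P z"]] assms(3)[of z] assms(4)[of z] v_nonneg[of "P z"]
    by (simp add: abs_mult)
  then show "AE y in M. \<bar>\<kappa> (x + y) * v (P (x + y))\<bar> \<le> k" by simp
qed simp

section \<open>Solutions between barriers\<close>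

text \<open>Monotonicity of \<open>T P x = F / avg (\<kappa> \<cdot> v \<circ> P) x\<close> makes the iterates of \<open>T\<close> from \<open>a\<close> increase
and stay below \<open>b\<close>. The bound \<open>r\<close> with \<open>v r > 0\<close> keeps the denominators away from \<open>0\<close>.
If the road does not improve to the right, \<open>T\<close> also preserves monotonicity in \<open>x\<close>.\<close>

lemma monotone_iteration:
  fixes \<kappa> a b :: "real \<Rightarrow> real" and F r k1 k2 :: real
  assumes \<kappa>_meas [measurable]: "\<kappa> \<in> borel_measurable borel"
    and k1: "0 < k1" and \<kappa>_ge: "\<And>z. k1 \<le> \<kappa> z" and \<kappa>_le: "\<And>z. \<kappa> z \<le> k2"
    and a_meas [measurable]: "a \<in> borel_measurable borel"
    and b_meas [measurable]: "b \<in> borel_measurable borel"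
    and a_nonneg: "\<And>x. 0 \<le> a x" and ab: "\<And>x. a x \<le> b x" and br: "\<And>x. b x \<le> r"
    and vr: "0 < v r" and F: "0 \<le> F"
    and sub: "\<And>x. a x * avg (\<lambda>z. \<kappa> z * v (a z)) x \<le> F"
    and super: "\<And>x. F \<le> b x * avg (\<lambda>z. \<kappa> z * v (b z)) x"
  obtains P where "P \<in> borel_measurable borel" "\<And>x. a x \<le> P x" "\<And>x. P x \<le> b x"
    "\<And>x. P x * avg (\<lambda>z. \<kappa> z * v (P z)) x = F"
    "antimono \<kappa> \<Longrightarrow> mono a \<Longrightarrow> mono P"
proof -
  define J where "J P = avg (\<lambda>z. \<kappa> z * v (P z))" for P :: "real \<Rightarrow> real"
  have \<kappa>_nonneg: "0 \<le> \<kappa> z" for z using k1 \<kappa>_ge[of z] by linarith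
  have int [simp]: "integrable M (\<lambda>y. \<kappa> (x + y) * v (P (x + y)))"
    if "P \<in> borel_measurable borel" for P x
    by (rule integrable_flow[OF \<kappa>_meas that \<kappa>_nonneg \<kappa>_le])
  have J_anti: "J Q x \<le> J P x"
    if "P \<in> borel_measurable borel" "Q \<in> borel_measurable borel" "\<And>z. P z \<le> Q z" for P Q x
    unfolding J_def
    by (rule avg_mono) (use that in \<open>auto intro!: mult_left_mono v_antiD \<kappa>_nonneg\<close>)
  have J_pos: "0 < J P x" if "P \<in> borel_measurable borel" "\<And>z. P z \<le> r" for P x
  proof -
    have "k1 * v r = avg (\<lambda>_. k1 * v r) x" by (simp add: avg_const)
    also have "\<dots> \<le> J P x"
      unfolding J_def
      by (rule avg_mono) (use that k1 vr in \<open>auto intro!: mult_mono v_antiD \<kappa>_nonneg \<kappa>_ge\<close>)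
    finally show ?thesis using k1 vr by (smt (verit) mult_pos_pos)
  qed
  have J_meas [measurable]: "J P \<in> borel_measurable borel" if [measurable]: "P \<in> borel_measurable borel" for P
    unfolding J_def by measurable
  define p where "p n = ((\<lambda>P x. F / J P x) ^^ n) a" for n
  have p0: "p 0 = a" and pS: "p (Suc n) = (\<lambda>x. F / J (p n) x)" for n
    by (auto simp: p_def)
  have p_meas [measurable]: "p n \<in> borel_measurable borel" for n
    by (induction n) (auto simp: p0 pS)
  have p: "(\<forall>x. p n x \<le> b x) \<and> (\<forall>x. p n x \<le> p (Suc n) x)" for n
  proof (induction n)
    case 0
    have "a x \<le> F / J a x" for x
    proof -
      have "a z \<le> r" for z using ab[of z] br[of z] by linarith
      then have "0 < J a x" by (intro J_pos) auto
      then show ?thesis using sub[of x] by (simp add: J_def pos_le_divide_eq)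
    qed
    then show ?case by (simp add: p0 pS ab)
  next
    case (Suc n)
    have le_r: "p n z \<le> r" for z using Suc br[of z] order_trans by blast
    have up: "p (Suc n) x \<le> b x" for x
    proof -
      have "F / J (p n) x \<le> F / J b x"
        using J_anti[of "p n" b x] J_pos[of b x] Suc br F by (auto intro!: divide_left_mono mult_pos_pos J_pos le_r)
      also have "\<dots> \<le> b x"
        using super[of x] J_pos[of b x] br by (auto simp: J_def[symmetric] field_simps)
      finally show ?thesis by (simp add: pS)
    qed
    have le_r': "p (Suc n) z \<le> r" for z using up br[of z] order_trans by blast
    have "F / J (p n) x \<le> F / J (p (Suc n)) x" for x
      using J_anti[of "p n" "p (Suc n)" x] Suc F
      by (intro divide_left_mono mult_pos_pos J_pos le_r le_r') auto
    then show ?case using up by (simp add: pS)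
  qed
  have inc: "incseq (\<lambda>n. p n x)" for x using p by (auto intro: incseq_SucI)
  have p_ge: "a x \<le> p n x" for n x using inc[of x] p0 by (metis incseqD le0)
  have "\<exists>l. (\<lambda>n. p n x) \<longlonglongrightarrow> l" for x
  proof -
    obtain l where "(\<lambda>n. p n x) \<longlonglongrightarrow> l"
      by (rule incseq_convergent[OF inc[of x], of "b x"]) (use p in auto)
    then show ?thesis ..
  qed
  then obtain P where P: "\<And>x. (\<lambda>n. p n x) \<longlonglongrightarrow> P x" by metis
  have P_meas [measurable]: "P \<in> borel_measurable borel"
    by (rule borel_measurable_LIMSEQ_real[where u = p]) (use P in auto)
  have aP: "a x \<le> P x" for x using P[of x] p_ge by (intro LIMSEQ_le_const) auto
  have Pb: "P x \<le> b x" for x using P[of x] p by (intro LIMSEQ_le_const2) auto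
  have J_lim: "(\<lambda>n. J (p n) x) \<longlonglongrightarrow> J P x" for x
    unfolding J_def avg_def
  proof (rule integral_dominated_convergence[where w = "\<lambda>_. k2"])
    have "isCont v z" for z using v_cont by (simp add: continuous_on_eq_continuous_at)
    then have "(\<lambda>n. v (p n z)) \<longlonglongrightarrow> v (P z)" for z
      using P[of z] by (rule isCont_tendsto_compose)
    then show "AE y in M. (\<lambda>n. \<kappa> (x + y) * v (p n (x + y))) \<longlonglongrightarrow> \<kappa> (x + y) * v (P (x + y))"
      by (auto intro!: tendsto_intros)
    have "\<bar>\<kappa> z * v q\<bar> \<le> k2" for z q
      using mult_mono[OF \<kappa>_le[of z] v_le_1[of q]] \<kappa>_nonneg[of z] \<kappa>_le[of z] v_nonneg[of q]
      by (simp add: abs_mult)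
    then show "AE y in M. norm (\<kappa> (x + y) * v (p n (x + y))) \<le> k2" for n by simp
  qed auto
  have JP_pos: "0 < J P x" for x using Pb br by (intro J_pos) (auto intro: order_trans)
  have "P x * J P x = F" for x
  proof -
    have "(\<lambda>n. p (Suc n) x) \<longlonglongrightarrow> F / J P x"
      unfolding pS using J_lim[of x] JP_pos[of x] by (auto intro!: tendsto_intros)
    then have "P x = F / J P x" using LIMSEQ_unique LIMSEQ_Suc[OF P[of x]] by blast
    then show ?thesis using JP_pos[of x] by (simp add: field_simps)
  qed
  moreover have "mono P" if \<kappa>_anti: "antimono \<kappa>" and "mono a"
  proof -
    have le_r: "p n z \<le> r" for n z using p br[of z] order_trans by blast
    have "mono (p n)" for n
    proof (induction n)
      case (Suc n)
      show ?case unfolding pS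
      proof (rule monoI)
        fix x x' :: real assume "x \<le> x'"
        then have "J (p n) x' \<le> J (p n) x"
          unfolding J_def using Suc \<kappa>_anti
          by (intro avg_mono) (auto intro!: mult_mono v_antiD v_nonneg \<kappa>_nonneg simp: antimono_def mono_def)
        then show "F / J (p n) x \<le> F / J (p n) x'"
          using F by (intro divide_left_mono mult_pos_pos J_pos le_r) auto
      qed
    qed (use that p0 in auto)
    then have "P x \<le> P x'" if "x \<le> x'" for x x'
      using that by (intro LIMSEQ_le[OF P[of x] P[of x']]) (auto simp: mono_def)
    then show ?thesis by (rule monoI)
  qed
  ultimately show ?thesis using that[of P] aP Pb by (auto simp: J_def)
qed

section \<open>Exponential barriers\<close>

lemma integrable_exp: "integrable M (\<lambda>y. exp (\<sigma> * y))"
proof -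
  have bound: "\<sigma> * y \<le> \<bar>\<sigma>\<bar> * h" if "0 < y" "y < h" for y
    using that by (intro mult_mono) auto
  have "AE y in M. \<bar>exp (\<sigma> * (0 + y))\<bar> \<le> exp (\<bar>\<sigma>\<bar> * h)"
    using supp_M by eventually_elim (use bound in simp)
  then show ?thesis
    using integrable_shift[of "\<lambda>y. exp (\<sigma> * y)" 0 "exp (\<bar>\<sigma>\<bar> * h)"] by simp
qed

lemma avg_exp: "avg (\<lambda>z. exp (\<sigma> * z)) x = exp (\<sigma> * x) * avg (\<lambda>z. exp (\<sigma> * z)) 0"
  by (simp add: avg_def distrib_left exp_add)

lemma integrable_exp_shift: "integrable M (\<lambda>y. exp (\<sigma> * (x + y)))"
  using integrable_exp[of \<sigma>] by (simp add: distrib_left exp_add)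

text \<open>By the tangent inequality for the concave \<open>v\<close>, the average speed over \<open>\<rho> - u\<close> is at most
\<open>v \<rho> + n \<cdot> avg u\<close>. The hypothesis on the rate says that \<open>u = A exp (\<sigma> x)\<close> is a supersolution
of the linearised equation, \<open>\<rho> n \<cdot> avg u \<le> v \<rho> \<cdot> u\<close>, and the quadratic term left over in the
product with \<open>\<rho> - u\<close> has the favourable sign. Both signs of \<open>\<sigma>\<close> occur: decay towards
plus infinity at the right state, towards minus infinity at the left one.\<close>

lemma exponential_subsolution:
  assumes \<rho>: "0 \<le> \<rho>" and n: "0 \<le> n" and A: "0 \<le> A"
    and tangent: "\<And>r. 0 \<le> r \<Longrightarrow> r \<le> \<rho> \<Longrightarrow> v r \<le> v \<rho> + n * (\<rho> - r)"
    and rate: "\<rho> * n * avg (\<lambda>z. exp (\<sigma> * z)) 0 \<le> v \<rho>"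
  defines "a \<equiv> \<lambda>x. max 0 (\<rho> - A * exp (\<sigma> * x))"
  shows "a x * avg (\<lambda>z. v (a z)) x \<le> \<rho> * v \<rho>"
proof (cases "a x = 0")
  case True
  then show ?thesis using \<rho> v_nonneg by simp
next
  case False
  define u where "u = A * exp (\<sigma> * x)"
  define L where "L = avg (\<lambda>z. exp (\<sigma> * z)) 0"
  have au: "a x = \<rho> - u" "u \<le> \<rho>" using False by (auto simp: a_def u_def)
  have u: "0 \<le> u" using A by (simp add: u_def)
  have L: "0 \<le> L" unfolding L_def avg_def by simp
  have [measurable]: "a \<in> borel_measurable borel" unfolding a_def by measurable
  have "avg (\<lambda>z. v (a z)) x \<le> avg (\<lambda>z. v \<rho> + n * (A * exp (\<sigma> * z))) x"
  proof (rule avg_mono)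
    show "integrable M (\<lambda>y. v (a (x + y)))"
      using integrable_flow[of "\<lambda>_. 1" a 1 x] by simp
    show "integrable M (\<lambda>y. v \<rho> + n * (A * exp (\<sigma> * (x + y))))"
      using integrable_exp_shift by simp
    fix y
    have "v (a (x + y)) \<le> v \<rho> + n * (\<rho> - a (x + y))"
      using A \<rho> by (intro tangent) (auto simp: a_def)
    also have "n * (\<rho> - a (x + y)) \<le> n * (A * exp (\<sigma> * (x + y)))"
      using n by (intro mult_left_mono) (auto simp: a_def)
    finally show "v (a (x + y)) \<le> v \<rho> + n * (A * exp (\<sigma> * (x + y)))" by simp
  qed
  also have "\<dots> = v \<rho> + n * (A * avg (\<lambda>z. exp (\<sigma> * z)) x)"
    unfolding avg_def using integrable_exp_shift by (simp add: prob_space)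
  also have "\<dots> = v \<rho> + n * u * L"
    by (subst avg_exp) (simp add: u_def L_def)
  finally have "a x * avg (\<lambda>z. v (a z)) x \<le> (\<rho> - u) * (v \<rho> + n * u * L)"
    unfolding au using au(2) by (intro mult_left_mono) auto
  also have "\<dots> = \<rho> * v \<rho> - u * (v \<rho> - \<rho> * n * L) - n * u * u * L"
    by (simp add: algebra_simps)
  also have "\<dots> \<le> \<rho> * v \<rho>"
  proof -
    have "0 \<le> u * (v \<rho> - \<rho> * n * L)" using u rate by (simp add: L_def)
    moreover have "0 \<le> n * u * u * L" using n u L by simp
    ultimately show ?thesis by linarith
  qed
  finally show ?thesis .
qed

text \<open>The Laplace transform of \<open>M\<close> is \<open>1\<close> at \<open>0\<close>, tends to \<open>0\<close> because \<open>M\<close> does not charge \<open>0\<close>, and is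
continuous, so it attains the value \<open>1 / c\<close>.\<close>

lemma decay_rate_exists:
  assumes "1 < c"
  obtains \<mu> where "0 < \<mu>" "c * avg (\<lambda>z. exp (-\<mu> * z)) 0 = 1"
proof -
  define L where "L l = avg (\<lambda>z. exp (-l * z)) 0" for l
  have L0: "L 0 = 1" by (simp add: L_def avg_const)
  have lim: "(\<lambda>n. L (real n)) \<longlonglongrightarrow> (\<integral>y. 0 \<partial>M)"
    unfolding L_def avg_def
  proof (rule integral_dominated_convergence[where w = "\<lambda>_. 1"])
    have "(\<lambda>n. exp (- real n * (0 + y))) \<longlonglongrightarrow> 0" if "0 < y" for y
    proof -
      have "(\<lambda>n. exp (- y) ^ n) \<longlonglongrightarrow> 0" using that by (intro LIMSEQ_power_zero) auto
      then show ?thesis by (simp add: exp_of_nat_mult[symmetric] mult.commute)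
    qed
    then show "AE y in M. (\<lambda>n. exp (- real n * (0 + y))) \<longlonglongrightarrow> 0"
      using supp_M by (auto elim!: eventually_mono)
    show "AE y in M. norm (exp (- real n * (0 + y))) \<le> 1" for n
      using supp_M by (auto elim!: eventually_mono)
  qed auto
  then have "\<forall>\<^sub>F n in sequentially. L (real n) < 1 / c"
    using assms by (intro order_tendstoD(2)[where y = 0]) auto
  then obtain n where n: "L (real n) < 1 / c" by (auto simp: eventually_sequentially)
  have "continuous_on {0..real n} L"
    unfolding continuous_on_sequentially
  proof (intro allI ballI impI, elim conjE)
    fix s :: "nat \<Rightarrow> real" and l assume s: "\<forall>n'. s n' \<in> {0..real n}" "s \<longlonglongrightarrow> l"
    show "(L \<circ> s) \<longlonglongrightarrow> L l"
      unfolding L_def avg_def comp_def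
    proof (rule integral_dominated_convergence[where w = "\<lambda>_. 1"])
      show "AE y in M. (\<lambda>i. exp (- s i * (0 + y))) \<longlonglongrightarrow> exp (- l * (0 + y))"
        using s(2) by (auto intro!: tendsto_intros)
      show "AE y in M. norm (exp (- s i * (0 + y))) \<le> 1" for i
        using supp_M s(1) by (auto elim!: eventually_mono)
    qed auto
  qed
  then have "\<exists>l\<ge>0. l \<le> real n \<and> L l = 1 / c"
    using n L0 assms by (intro IVT2') auto
  then obtain l where l: "0 \<le> l" "L l = 1 / c" by blast
  with L0 assms have "l \<noteq> 0" by auto
  with l show ?thesis using that[of l] assms by (auto simp: L_def)
qed

section \<open>A transition on the homogeneous road\<close>

text \<open>The assumption \<open>v \<rho> < \<rho> n\<close>, with \<open>n\<close> the slope of \<open>- v\<close> at \<open>\<rho>\<close>, says that the flux decreases at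
\<open>\<rho>\<close>. The exact exponential rate is needed: with \<open>e x = exp (- \<mu> x)\<close> the linear parts of the barriers
\<open>max 0 (\<rho> - e)\<close> and \<open>\<rho> - max 0 (e - K e\<^sup>2)\<close> balance, and the errors are of order \<open>e\<^sup>2\<close>.\<close>

lemma homogeneous_transition:
  assumes \<rho>: "0 < \<rho>" and v\<rho>: "0 < v \<rho>" and unstable: "v \<rho> < \<rho> * n" and C: "0 \<le> C"
    and tangent: "\<And>r. 0 \<le> r \<Longrightarrow> r \<le> \<rho> \<Longrightarrow> v r \<le> v \<rho> + n * (\<rho> - r)"
    and parabola: "\<And>r. 0 \<le> r \<Longrightarrow> r \<le> \<rho> \<Longrightarrow> v \<rho> + n * (\<rho> - r) - C * (\<rho> - r)\<^sup>2 \<le> v r"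
  obtains P where "P \<in> borel_measurable borel" "mono P" "\<And>x. 0 \<le> P x" "\<And>x. P x < \<rho>"
    "(P \<longlongrightarrow> \<rho>) at_top" "\<And>x. P x * avg (\<lambda>z. v (P z)) x = \<rho> * v \<rho>"
proof -
  have n: "0 < n" using \<rho> v\<rho> unstable by (metis less_trans zero_less_mult_pos)
  obtain \<mu> where \<mu>: "0 < \<mu>" "\<rho> * n / v \<rho> * avg (\<lambda>z. exp (-\<mu> * z)) 0 = 1"
    using decay_rate_exists[of "\<rho> * n / v \<rho>"] unstable v\<rho> by auto
  define L where "L = avg (\<lambda>z. exp (-\<mu> * z)) 0"
  define q where "q = avg (\<lambda>z. exp (-(2 * \<mu>) * z)) 0"
  define e where "e x = exp (-\<mu> * x)" for x
  have e_pos: "0 < e x" for x by (simp add: e_def)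
  have e_sq: "exp (-(2 * \<mu>) * x) = (e x)\<^sup>2" for x
    by (simp add: e_def power2_eq_square exp_add[symmetric])
  have L: "\<rho> * n * L = v \<rho>" using \<mu>(2) v\<rho> by (simp add: L_def field_simps)
  have L_pos: "0 < L" using L v\<rho> n \<rho> by (metis zero_less_mult_pos mult_pos_pos)
  have qL: "q < L"
    unfolding q_def L_def avg_def
  proof (rule integral_less_AE_space)
    show "AE y in M. exp (-(2 * \<mu>) * (0 + y)) < exp (-\<mu> * (0 + y))"
      using supp_M by eventually_elim (use \<mu>(1) in simp)
  qed (use integrable_exp[of "-\<mu>"] integrable_exp[of "-(2 * \<mu>)"] emeasure_space_1 in auto)
  have L_le: "L < 1" using L unstable \<rho> n v\<rho> by (metis mult.right_neutral mult_less_cancel_left_pos mult_pos_pos)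
  have q_nonneg: "0 \<le> q" unfolding q_def avg_def by simp
  \<comment> \<open>The correction \<open>K e\<^sup>2\<close> decays at the rate \<open>2 \<mu>\<close>, where the linearised operator
    contracts; \<open>G\<close> measures by how much, and \<open>K\<close> is chosen so that \<open>K G\<close> outweighs all quadratic
    errors. The summand \<open>1 / \<rho>\<close> keeps \<open>b\<close> nonnegative.\<close>
  define G where "G = v \<rho> - \<rho> * n * q"
  have G: "0 < G" using L qL \<rho> n unfolding G_def by (metis diff_gt_0_iff_gt mult_pos_pos mult_strict_left_mono)
  define K where "K = (\<rho> * C + n) / G + 1 / \<rho>"
  have K1: "\<rho> * C + n \<le> K * G" using G \<rho> by (simp add: K_def field_simps)
  have K2: "1 \<le> K * \<rho>" using G \<rho> C n by (simp add: K_def field_simps)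
  have K: "0 < K" using K2 \<rho> by (metis less_le_trans zero_less_one zero_less_mult_pos2)
  define \<beta> where "\<beta> x = max 0 (e x - K * (e x)\<^sup>2)" for x
  define a where "a x = max 0 (\<rho> - 1 * exp (-\<mu> * x))" for x
  define b where "b x = \<rho> - \<beta> x" for x
  have e_meas [measurable]: "e \<in> borel_measurable borel" unfolding e_def by measurable
  have b_meas [measurable]: "b \<in> borel_measurable borel" unfolding b_def \<beta>_def by measurable
  have a_meas: "a \<in> borel_measurable borel" unfolding a_def by measurable
  have \<beta>_nonneg: "0 \<le> \<beta> x" for x by (simp add: \<beta>_def)
  have \<beta>_le_e: "\<beta> x \<le> e x" for x using K e_pos[of x] by (simp add: \<beta>_def)
  have \<beta>_le: "\<beta> x \<le> \<rho>" for x
  proof (cases "e x \<le> \<rho>")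
    case False
    then have "1 \<le> K * e x" using K2 K by (meson less_imp_le mult_left_mono not_le order_trans)
    then have "e x \<le> K * (e x)\<^sup>2" using e_pos[of x] by (simp add: power2_eq_square mult.assoc[symmetric])
    then show ?thesis using \<rho> by (simp add: \<beta>_def)
  qed (use \<beta>_le_e[of x] in linarith)
  have sub: "a x * avg (\<lambda>z. v (a z)) x \<le> \<rho> * v \<rho>" for x
    unfolding a_def
    by (rule exponential_subsolution[OF _ _ _ tangent]) (use \<rho> n L in \<open>auto simp: L_def\<close>)
  have super: "\<rho> * v \<rho> \<le> b x * avg (\<lambda>z. v (b z)) x" for x
  proof (cases "\<beta> x = 0")
    case True
    have "avg (\<lambda>_. v \<rho>) x \<le> avg (\<lambda>z. v (b z)) x"
      using integrable_flow[of "\<lambda>_. 1" b 1 x] b_meas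
      by (intro avg_mono v_antiD) (auto simp: b_def \<beta>_nonneg)
    then show ?thesis using True \<rho> by (simp add: b_def avg_const)
  next
    case False
    define w where "w = e x"
    have w: "0 < w" using e_pos by (simp add: w_def)
    have \<beta>x: "\<beta> x = w - K * w\<^sup>2" using False by (simp add: \<beta>_def w_def)
    have "avg (\<lambda>z. v \<rho> + n * (exp (-\<mu> * z) - K * exp (-(2 * \<mu>) * z)) - C * exp (-(2 * \<mu>) * z)) x
        \<le> avg (\<lambda>z. v (b z)) x"
    proof (rule avg_mono)
      show "integrable M (\<lambda>y. v (b (x + y)))"
        using integrable_flow[of "\<lambda>_. 1" b 1 x] b_meas by simp
      fix y
      have "(\<beta> (x + y))\<^sup>2 \<le> (e (x + y))\<^sup>2"
        using \<beta>_nonneg \<beta>_le_e by (intro power_mono) auto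
      moreover have "e (x + y) - K * (e (x + y))\<^sup>2 \<le> \<beta> (x + y)" by (simp add: \<beta>_def)
      ultimately have "v \<rho> + n * (e (x + y) - K * (e (x + y))\<^sup>2) - C * (e (x + y))\<^sup>2
          \<le> v \<rho> + n * \<beta> (x + y) - C * (\<beta> (x + y))\<^sup>2"
        using n C by (intro diff_mono add_mono mult_left_mono) auto
      also have "\<dots> \<le> v (b (x + y))"
        using parabola[of "b (x + y)"] \<beta>_nonneg[of "x + y"] \<beta>_le[of "x + y"] by (simp add: b_def)
      finally show "v \<rho> + n * (exp (-\<mu> * (x + y)) - K * exp (-(2 * \<mu>) * (x + y)))
          - C * exp (-(2 * \<mu>) * (x + y)) \<le> v (b (x + y))"
        unfolding e_sq by (simp add: e_def)
    qed (use integrable_exp_shift[of "-\<mu>" x] integrable_exp_shift[of "-(2 * \<mu>)" x] in simp)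
    also have "avg (\<lambda>z. v \<rho> + n * (exp (-\<mu> * z) - K * exp (-(2 * \<mu>) * z)) - C * exp (-(2 * \<mu>) * z)) x
        = v \<rho> + n * (avg (\<lambda>z. exp (-\<mu> * z)) x - K * avg (\<lambda>z. exp (-(2 * \<mu>) * z)) x)
          - C * avg (\<lambda>z. exp (-(2 * \<mu>) * z)) x"
      unfolding avg_def using integrable_exp_shift[of "-\<mu>" x] integrable_exp_shift[of "-(2*\<mu>)" x]
      by (simp add: prob_space)
    also have "avg (\<lambda>z. exp (-\<mu> * z)) x = w * L"
      by (subst avg_exp) (simp add: w_def e_def L_def)
    also have "avg (\<lambda>z. exp (-(2 * \<mu>) * z)) x = w\<^sup>2 * q"
      by (subst avg_exp) (simp only: w_def e_sq q_def)
    finally have avg_ge: "v \<rho> + n * (w * L - K * (w\<^sup>2 * q)) - C * (w\<^sup>2 * q) \<le> avg (\<lambda>z. v (b z)) x" .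
    \<comment> \<open>Expanding \<open>(\<rho> - \<beta> x) \<cdot> (\<dots>)\<close> with \<open>\<rho> n L = v \<rho>\<close> removes the terms of order \<open>w\<close>.\<close>
    have "\<rho> * v \<rho> \<le> \<rho> * v \<rho> + w\<^sup>2 * (K * G - \<rho> * C * q - n * L)"
    proof -
      have "\<rho> * C * q \<le> \<rho> * C * 1" using \<rho> C qL L_le by (intro mult_left_mono) auto
      moreover have "n * L \<le> n * 1" using n L_le by (intro mult_left_mono) auto
      ultimately show ?thesis using K1 by simp
    qed
    also have "\<dots> \<le> \<rho> * v \<rho> + w\<^sup>2 * (K * G - \<rho> * C * q - n * L)
        + (K * w\<^sup>2 * w * n * L + \<beta> x * (n * K + C) * w\<^sup>2 * q)"
      using K w n L_pos \<beta>_nonneg[of x] C q_nonneg by simp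
    also have "\<dots> = (\<rho> - \<beta> x) * (v \<rho> + n * (w * L - K * (w\<^sup>2 * q)) - C * (w\<^sup>2 * q))"
      unfolding \<beta>x G_def L[symmetric] by (simp add: algebra_simps power2_eq_square)
    also have "\<dots> \<le> b x * avg (\<lambda>z. v (b z)) x"
      unfolding b_def[of x] using \<beta>_le[of x] avg_ge by (intro mult_left_mono) auto
    finally show ?thesis .
  qed
  obtain P where P: "P \<in> borel_measurable borel" "\<And>x. a x \<le> P x" "\<And>x. P x \<le> b x"
    "\<And>x. P x * avg (\<lambda>z. 1 * v (P z)) x = \<rho> * v \<rho>" "antimono (\<lambda>_::real. 1::real) \<Longrightarrow> mono a \<Longrightarrow> mono P"
  proof (rule monotone_iteration[of "\<lambda>_. 1" 1 1 a b \<rho> "\<rho> * v \<rho>"])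
    show "a x \<le> b x" for x
      using \<beta>_le[of x] \<beta>_le_e[of x] by (simp add: a_def b_def e_def)
    show "b x \<le> \<rho>" for x by (simp add: b_def \<beta>_nonneg)
  qed (use a_meas b_meas v\<rho> \<rho> sub super in \<open>auto simp: a_def\<close>)
  have "mono a"
    unfolding a_def using \<mu>(1) by (intro monoI max.mono diff_mono) auto
  with P(5) have mono_P: "mono P" by (simp add: antimono_def)
  have P_less: "P x < \<rho>" for x
  proof -
    \<comment> \<open>Beyond \<open>ln (2 K) / \<mu>\<close> one has \<open>K e \<le> 1 / 2\<close>, so \<open>\<beta>\<close> is positive there.\<close>
    define x' where "x' = max x (ln (2 * K) / \<mu>)"
    have "ln (2 * K) / \<mu> \<le> x'" by (simp add: x'_def)
    then have "ln (2 * K) \<le> \<mu> * x'" using \<mu>(1) by (simp add: field_simps)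
    then have "exp (-\<mu> * x') \<le> exp (- ln (2 * K))" by simp
    then have "e x' \<le> 1 / (2 * K)" using K by (simp add: e_def exp_minus inverse_eq_divide)
    then have "K * e x' < 1" using K by (simp add: field_simps)
    then have "e x' * (K * e x') < e x' * 1" using e_pos by (intro mult_strict_left_mono) auto
    then have "0 < \<beta> x'" by (simp add: \<beta>_def power2_eq_square algebra_simps)
    then have "P x' < \<rho>" using P(3)[of x'] by (simp add: b_def)
    moreover have "P x \<le> P x'" using mono_P by (auto simp: x'_def mono_def)
    ultimately show ?thesis by linarith
  qed
  have "(P \<longlongrightarrow> \<rho>) at_top"
  proof (rule tendsto_sandwich)
    have "filterlim (\<lambda>x. -\<mu> * x) at_bot at_top"
      using \<mu>(1) by (intro filterlim_tendsto_neg_mult_at_bot[OF tendsto_const _ filterlim_ident]) auto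
    then have "((\<lambda>x. exp (-\<mu> * x)) \<longlongrightarrow> 0) at_top"
      by (rule filterlim_compose[OF exp_at_bot])
    then show "((\<lambda>x. \<rho> - exp (-\<mu> * x)) \<longlongrightarrow> \<rho>) at_top"
      using tendsto_diff[OF tendsto_const[of \<rho>]] by fastforce
    show "\<forall>\<^sub>F x in at_top. \<rho> - exp (-\<mu> * x) \<le> P x"
      using P(2) by (auto simp: a_def)
    show "\<forall>\<^sub>F x in at_top. P x \<le> \<rho>"
      using P_less by (intro always_eventually allI less_imp_le)
  qed auto
  moreover have "0 \<le> P x" for x using P(2)[of x] by (simp add: a_def)
  ultimately show ?thesis using that[of P] P mono_P P_less by simp
qed

text \<open>Sampling along steps of length \<open>h\<close> bounds every average by the speed at the next sample point,
so the limit \<open>l\<close> at minus infinity satisfies \<open>l v l \<le> F\<close>.\<close>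

lemma transition_descends:
  assumes "mono P" and P_less: "\<And>x. P x < \<rho>" and P_nonneg: "\<And>x. 0 \<le> P x"
    and P_meas [measurable]: "P \<in> borel_measurable borel"
    and P_eq: "\<And>x. P x * avg (\<lambda>z. v (P z)) x = F"
    and gap: "\<And>r. \<sigma> \<le> r \<Longrightarrow> r < \<rho> \<Longrightarrow> F < r * v r"
  shows "\<exists>x. P x \<le> \<sigma>"
proof (rule ccontr)
  assume "\<not> ?thesis"
  then have above: "\<sigma> < P x" for x by (simp add: not_le)
  define p where "p k = P (- (real k * h))" for k
  have "decseq p"
    unfolding p_def using \<open>mono P\<close> h_pos by (intro decseq_SucI) (auto simp: mono_def algebra_simps)
  moreover have "\<sigma> \<le> p k" for k using above[of "- (real k * h)"] by (simp add: p_def)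
  ultimately obtain l where l: "p \<longlonglongrightarrow> l" "\<And>k. l \<le> p k" using decseq_convergent by blast
  have "\<sigma> \<le> l" using l(1) above by (intro LIMSEQ_le_const) (auto simp: p_def intro!: less_imp_le)
  moreover have "l < \<rho>" using l(2)[of 0] P_less[of 0] by (simp add: p_def)
  ultimately have "F < l * v l" by (rule gap)
  have "p (Suc k) * v (p k) \<le> F" for k
  proof -
    define x where "x = - (real (Suc k) * h)"
    have xh: "x + h = - (real k * h)" by (simp add: x_def algebra_simps)
    have "avg (\<lambda>_. v (P (x + h))) x \<le> avg (\<lambda>z. v (P z)) x"
      using integrable_flow[of "\<lambda>_. 1" P 1 x] \<open>mono P\<close>
      by (intro avg_mono v_antiD) (auto simp: mono_def)
    then have "P x * v (P (x + h)) \<le> F"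
      using mult_left_mono[OF _ P_nonneg[of x]] P_eq[of x] by (fastforce simp: avg_const)
    then show ?thesis unfolding xh by (simp add: p_def x_def)
  qed
  moreover have "(\<lambda>k. p (Suc k) * v (p k)) \<longlonglongrightarrow> l * v l"
  proof (rule tendsto_mult[OF LIMSEQ_Suc[OF l(1)]])
    show "(\<lambda>k. v (p k)) \<longlonglongrightarrow> v l"
      using v_cont l(1) by (intro isCont_tendsto_compose[of l v]) (auto simp: continuous_on_eq_continuous_at)
  qed
  ultimately have "l * v l \<le> F" by (intro LIMSEQ_le_const2) auto
  with \<open>F < l * v l\<close> show False by simp
qed

section \<open>Profiles across the jump\<close>

text \<open>The translated homogeneous solution is \<open>q\<close>. It is a subsolution on the whole road, because
lowering \<open>\<kappa>\<close> on the left lowers the averages. At \<open>x < 0\<close> the constant \<open>\<rho>m\<close> satisfies the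
inequality of a supersolution because \<open>q\<close> is at most \<open>\<rho>m\<close> on the whole look-ahead interval and
\<open>\<kappa>\<close> is at least \<open>km\<close> there. On \<open>x \<ge> 0\<close> both barriers
equal \<open>q\<close>, which fixes the solution there.\<close>

lemma interface_profile:
  assumes km: "0 < km" and kk: "km < kp"
    and \<rho>m: "0 < \<rho>m" "\<rho>m \<le> \<rho>p" and v\<rho>p: "0 < v \<rho>p"
    and n: "0 < n" and stable: "\<rho>m * n < v \<rho>m"
    and tangent: "\<And>r. 0 \<le> r \<Longrightarrow> r \<le> \<rho>m \<Longrightarrow> v r \<le> v \<rho>m + n * (\<rho>m - r)"
    and q_meas [measurable]: "q \<in> borel_measurable borel"
    and q_nonneg: "\<And>x. 0 \<le> q x" and q_le: "\<And>x. q x \<le> \<rho>p"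
    and q_low: "\<And>x. x \<le> h \<Longrightarrow> q x \<le> \<rho>m"
    and q_eq: "\<And>x. kp * (q x * avg (\<lambda>z. v (q z)) x) = km * (\<rho>m * v \<rho>m)"
  defines "\<kappa> \<equiv> \<lambda>x::real. if x < 0 then km else kp"
  obtains P where "P \<in> borel_measurable borel" "\<And>x. 0 \<le> P x" "\<And>x. P x \<le> \<rho>p"
    "\<And>x. P x * avg (\<lambda>z. \<kappa> z * v (P z)) x = km * (\<rho>m * v \<rho>m)"
    "\<And>x. 0 \<le> x \<Longrightarrow> P x = q x" "(P \<longlongrightarrow> \<rho>m) at_bot"
proof -
  define F where "F = km * (\<rho>m * v \<rho>m)"
  have v\<rho>m: "0 < v \<rho>m" using v_antiD[OF \<rho>m(2)] v\<rho>p by linarith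
  define \<nu> where "\<nu> = ln (v \<rho>m / (\<rho>m * n)) / h"
  have "1 < v \<rho>m / (\<rho>m * n)" using stable n \<rho>m by simp
  then have \<nu>: "0 < \<nu>" using h_pos by (simp add: \<nu>_def)
  have e\<nu>: "\<rho>m * n * exp (\<nu> * h) = v \<rho>m"
    using h_pos n \<rho>m v\<rho>m by (simp add: \<nu>_def)
  \<comment> \<open>This amplitude makes \<open>a\<close> vanish from \<open>- h\<close> on; where \<open>a\<close> is positive, the
    look-ahead interval lies entirely on the left road.\<close>
  define A where "A = \<rho>m * exp (\<nu> * h)"
  define a where "a x = max 0 (\<rho>m - A * exp (\<nu> * x))" for x
  have a_meas [measurable]: "a \<in> borel_measurable borel" unfolding a_def by measurable
  have a_le: "a x \<le> \<rho>m" for x using \<rho>m by (simp add: a_def A_def)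
  have a_nonneg: "0 \<le> a x" for x by (simp add: a_def)
  have a_zero: "a x = 0" if "-h \<le> x" for x
  proof -
    have "1 \<le> exp (\<nu> * h) * exp (\<nu> * x)"
      using that \<nu> by (simp add: exp_add[symmetric] distrib_left[symmetric])
    then show ?thesis using \<rho>m(1) by (simp add: a_def A_def mult.assoc)
  qed
  have a_sub: "a x * avg (\<lambda>z. v (a z)) x \<le> \<rho>m * v \<rho>m" for x
    unfolding a_def
  proof (rule exponential_subsolution[OF _ _ _ tangent])
    have "avg (\<lambda>z. exp (\<nu> * z)) 0 \<le> avg (\<lambda>_. exp (\<nu> * h)) 0"
      using integrable_exp_shift[of \<nu> 0] \<nu> by (intro avg_mono) auto
    then have "\<rho>m * n * avg (\<lambda>z. exp (\<nu> * z)) 0 \<le> \<rho>m * n * exp (\<nu> * h)"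
      using \<rho>m n by (intro mult_left_mono) (auto simp: avg_const)
    then show "\<rho>m * n * avg (\<lambda>z. exp (\<nu> * z)) 0 \<le> v \<rho>m" by (simp add: e\<nu>)
  qed (use \<rho>m n in \<open>auto simp: A_def\<close>)
  have \<kappa>_meas [measurable]: "\<kappa> \<in> borel_measurable borel" unfolding \<kappa>_def by measurable
  have \<kappa>_ge: "km \<le> \<kappa> z" and \<kappa>_le: "\<kappa> z \<le> kp" and \<kappa>_nonneg: "0 \<le> \<kappa> z" for z
    using kk km by (auto simp: \<kappa>_def)
  have int: "integrable M (\<lambda>y. \<kappa> (x + y) * v (f (x + y)))"
    and int': "integrable M (\<lambda>y. k * v (f (x + y)))"
    if "f \<in> borel_measurable borel" "0 \<le> k" for f x k
    using integrable_flow[OF \<kappa>_meas that(1) \<kappa>_nonneg \<kappa>_le]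
      integrable_flow[of "\<lambda>_. k" f k] that by auto
  have avg_cmult: "avg (\<lambda>z. k * g z) x = k * avg g x" for k g x
    by (simp add: avg_def)
  define lo where "lo x = max (q x) (a x)" for x
  define up where "up x = (if x < 0 then \<rho>m else q x)" for x
  have lo_meas [measurable]: "lo \<in> borel_measurable borel" unfolding lo_def by measurable
  have up_meas [measurable]: "up \<in> borel_measurable borel" unfolding up_def by measurable
  obtain P where P: "P \<in> borel_measurable borel" "\<And>x. lo x \<le> P x" "\<And>x. P x \<le> up x"
    "\<And>x. P x * avg (\<lambda>z. \<kappa> z * v (P z)) x = F"
  proof (rule monotone_iteration[of \<kappa> km kp lo up \<rho>p F, OF \<kappa>_meas km \<kappa>_ge \<kappa>_le lo_meas up_meas])
    show "0 \<le> lo x" for x using q_nonneg[of x] by (simp add: lo_def)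
    show "lo x \<le> up x" for x
      using q_low[of x] a_le[of x] a_zero[of x] q_nonneg[of x] h_pos
      by (auto simp: lo_def up_def)
    show "up x \<le> \<rho>p" for x using \<rho>m q_le by (simp add: up_def)
    show "0 \<le> F" using km \<rho>m v\<rho>m by (simp add: F_def)
    show "lo x * avg (\<lambda>z. \<kappa> z * v (lo z)) x \<le> F" for x
    proof (cases "a x \<le> q x")
      case True
      have "avg (\<lambda>z. \<kappa> z * v (lo z)) x \<le> avg (\<lambda>z. kp * v (q z)) x"
        using int[OF lo_meas, of 0 x] int'[OF q_meas, of kp x] km kk
        by (intro avg_mono mult_mono v_antiD) (auto simp: lo_def \<kappa>_le v_nonneg)
      then have "q x * avg (\<lambda>z. \<kappa> z * v (lo z)) x \<le> q x * (kp * avg (\<lambda>z. v (q z)) x)"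
        using q_nonneg[of x] by (intro mult_left_mono) (auto simp: avg_cmult)
      then show ?thesis using True q_eq[of x] by (simp add: lo_def F_def ac_simps)
    next
      case False
      then have "x < -h" using a_zero[of x] q_nonneg[of x] by (cases "-h \<le> x") auto
      then have "avg (\<lambda>z. \<kappa> z * v (lo z)) x \<le> avg (\<lambda>z. km * v (a z)) x"
        using int[OF lo_meas, of 0 x] int'[OF a_meas, of km x] km
        by (intro avg_mono mult_mono v_antiD) (auto simp: lo_def \<kappa>_def v_nonneg)
      then have "a x * avg (\<lambda>z. \<kappa> z * v (lo z)) x \<le> km * (a x * avg (\<lambda>z. v (a z)) x)"
        using mult_left_mono[OF _ a_nonneg[of x]] by (fastforce simp: avg_cmult ac_simps)
      also have "\<dots> \<le> F" unfolding F_def using a_sub km by (intro mult_left_mono) auto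
      finally show ?thesis using False by (simp add: lo_def)
    qed
    show "F \<le> up x * avg (\<lambda>z. \<kappa> z * v (up z)) x" for x
    proof (cases "x < 0")
      case True
      have "avg (\<lambda>_. km * v \<rho>m) x \<le> avg (\<lambda>z. \<kappa> z * v (up z)) x"
        using int[OF up_meas, of 0 x] km True q_low v\<rho>m
        by (intro avg_mono mult_mono v_antiD) (auto simp: up_def \<kappa>_ge \<kappa>_nonneg)
      then have "\<rho>m * (km * v \<rho>m) \<le> \<rho>m * avg (\<lambda>z. \<kappa> z * v (up z)) x"
        using \<rho>m by (intro mult_left_mono) (auto simp: avg_const)
      then show ?thesis using True by (simp add: up_def F_def ac_simps)
    next
      case False
      have "avg (\<lambda>z. kp * v (q z)) x \<le> avg (\<lambda>z. \<kappa> z * v (up z)) x"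
        using int[OF up_meas, of 0 x] int'[OF q_meas, of kp x] km kk False
        by (intro avg_mono) (auto simp: up_def \<kappa>_def)
      then have "q x * (kp * avg (\<lambda>z. v (q z)) x) \<le> q x * avg (\<lambda>z. \<kappa> z * v (up z)) x"
        using q_nonneg[of x] by (intro mult_left_mono) (auto simp: avg_cmult)
      then show ?thesis using False q_eq[of x] by (simp add: up_def F_def ac_simps)
    qed
  qed (use v\<rho>p in auto)
  have nonneg: "0 \<le> P x" for x using P(2)[of x] q_nonneg[of x] by (simp add: lo_def)
  have le: "P x \<le> \<rho>p" for x
    using P(3)[of x] \<rho>m q_le[of x] by (auto simp: up_def split: if_splits)
  have right: "P x = q x" if "0 \<le> x" for x
    using P(2,3)[of x] that by (simp add: lo_def up_def)
  have "(P \<longlongrightarrow> \<rho>m) at_bot"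
  proof (rule tendsto_sandwich)
    have "filterlim (\<lambda>x. \<nu> * x) at_bot at_bot"
      using \<nu> by (intro filterlim_tendsto_pos_mult_at_bot[OF tendsto_const _ filterlim_ident]) auto
    then have "((\<lambda>x. exp (\<nu> * x)) \<longlongrightarrow> 0) at_bot"
      by (rule filterlim_compose[OF exp_at_bot])
    then have "((\<lambda>x. \<rho>m - A * exp (\<nu> * x)) \<longlongrightarrow> \<rho>m - A * 0) at_bot"
      by (intro tendsto_intros)
    then show "((\<lambda>x. \<rho>m - A * exp (\<nu> * x)) \<longlongrightarrow> \<rho>m) at_bot" by simp
    show "\<forall>\<^sub>F x in at_bot. \<rho>m - A * exp (\<nu> * x) \<le> P x"
      using P(2) by (auto simp: lo_def a_def)
    show "\<forall>\<^sub>F x in at_bot. P x \<le> \<rho>m"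
      using eventually_gt_at_bot[of "0::real"]
    proof eventually_elim
      case (elim x)
      then show ?case using P(3)[of x] by (simp add: up_def)
    qed
  qed auto
  with that[of P] P nonneg le right show ?thesis by (simp add: F_def)
qed

end

section \<open>Concave velocities and unimodal fluxes\<close>

lemma mean_value_unit_interval:
  fixes f f' :: "real \<Rightarrow> real"
  assumes "\<And>x. x \<in> {0..1} \<Longrightarrow> (f has_real_derivative f' x) (at x within {0..1})"
    and "0 \<le> x" "x < y" "y \<le> 1"
  obtains z where "x < z" "z < y" "f y - f x = (y - x) * f' z"
proof -
  have "\<exists>z\<in>{x<..<y}. f y - f x = (*) (f' z) (y - x)"
  proof (rule mvt_simple[OF \<open>x < y\<close>])
    fix z assume "x \<le> z" "z \<le> y"
    then have "(f has_real_derivative f' z) (at z within {x..y})"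
      using assms by (intro has_field_derivative_subset[OF assms(1)]) auto
    then show "(f has_derivative (*) (f' z)) (at z within {x..y})"
      by (simp add: has_field_derivative_def)
  qed
  then show ?thesis using that by (auto simp: mult.commute)
qed

text \<open>The tangent line and a parabola of curvature \<open>-2 C\<close> enclose \<open>v\<close> to the left of \<open>\<rho>\<close>: the mean
value theorem is applied to \<open>v\<close> and then to \<open>v'\<close>.\<close>

lemma concave_tangent_parabola:
  fixes v v' v'' :: "real \<Rightarrow> real"
  assumes v: "\<And>r. r \<in> {0..1} \<Longrightarrow> (v has_real_derivative v' r) (at r within {0..1})"
    and v': "\<And>r. r \<in> {0..1} \<Longrightarrow> (v' has_real_derivative v'' r) (at r within {0..1})"
    and bounds: "\<And>r. r \<in> {0..1} \<Longrightarrow> -C \<le> v'' r" "\<And>r. r \<in> {0..1} \<Longrightarrow> v'' r \<le> 0"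
    and r: "0 \<le> r" "r \<le> \<rho>" "\<rho> \<le> 1"
  shows "v r \<le> v \<rho> + - v' \<rho> * (\<rho> - r)"
    and "v \<rho> + - v' \<rho> * (\<rho> - r) - C * (\<rho> - r)\<^sup>2 \<le> v r"
proof -
  have "v r \<le> v \<rho> + - v' \<rho> * (\<rho> - r) \<and> v \<rho> + - v' \<rho> * (\<rho> - r) - C * (\<rho> - r)\<^sup>2 \<le> v r"
  proof (cases "r = \<rho>")
    case False
    then have "r < \<rho>" using r by simp
    obtain z where z: "r < z" "z < \<rho>" "v \<rho> - v r = (\<rho> - r) * v' z"
      using mean_value_unit_interval[OF v r(1) \<open>r < \<rho>\<close> r(3)] by blast
    have "0 \<le> z" using z r by simp
    obtain y where y: "z < y" "y < \<rho>" "v' \<rho> - v' z = (\<rho> - z) * v'' y"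
      using mean_value_unit_interval[OF v' \<open>0 \<le> z\<close> z(2) r(3)] by blast
    have y01: "y \<in> {0..1}" using y z r by auto
    have C: "0 \<le> C" using bounds[OF y01] by linarith
    have "(\<rho> - z) * v'' y \<le> 0" using z bounds(2)[OF y01] by (simp add: mult_nonneg_nonpos)
    then have "v' \<rho> \<le> v' z" using y(3) by linarith
    then have 1: "(\<rho> - r) * v' \<rho> \<le> (\<rho> - r) * v' z" using r by (intro mult_left_mono) auto
    have "(\<rho> - z) * - v'' y \<le> (\<rho> - r) * C"
      using z r bounds[OF y01] by (intro mult_mono) auto
    then have "v' z \<le> v' \<rho> + C * (\<rho> - r)" using y(3) by (simp add: mult.commute)
    then have 2: "(\<rho> - r) * v' z \<le> (\<rho> - r) * (v' \<rho> + C * (\<rho> - r))"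
      using r by (intro mult_left_mono) auto
    show ?thesis using 1 2 z(3) by (simp add: algebra_simps power2_eq_square)
  qed simp
  then show "v r \<le> v \<rho> + - v' \<rho> * (\<rho> - r)"
    and "v \<rho> + - v' \<rho> * (\<rho> - r) - C * (\<rho> - r)\<^sup>2 \<le> v r" by auto
qed

lemma critical_density_slopes:
  assumes "critical_density v \<rho>hat" and "0 < k"
  obtains f' where "\<forall>r\<in>{0..1}. (flux v k has_real_derivative f' r) (at r within {0..1})"
    and "\<forall>r\<in>{0..<\<rho>hat}. 0 < f' r" and "\<forall>r\<in>{\<rho>hat<..1}. f' r < 0"
  using assms(1)[unfolded critical_density_def, THEN conjunct2, THEN conjunct2, rule_format, OF assms(2)]
  by auto

lemma flux_unimodal:
  assumes "critical_density v \<rho>hat" "0 < k"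
  shows "\<And>x y. 0 \<le> x \<Longrightarrow> x < y \<Longrightarrow> y \<le> \<rho>hat \<Longrightarrow> flux v k x < flux v k y"
    and "\<And>x y. \<rho>hat \<le> x \<Longrightarrow> x < y \<Longrightarrow> y \<le> 1 \<Longrightarrow> flux v k y < flux v k x"
proof -
  have \<rho>hat: "0 < \<rho>hat" "\<rho>hat < 1" using assms(1) by (auto simp: critical_density_def)
  obtain f' where f'_ball: "\<forall>r\<in>{0..1}. (flux v k has_real_derivative f' r) (at r within {0..1})"
    and pos: "\<forall>r\<in>{0..<\<rho>hat}. 0 < f' r" and neg: "\<forall>r\<in>{\<rho>hat<..1}. f' r < 0"
    by (rule critical_density_slopes[OF assms])
  note f' = bspec[OF f'_ball]
  show "flux v k x < flux v k y" if xy: "0 \<le> x" "x < y" "y \<le> \<rho>hat" for x y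
  proof -
    obtain z where z: "x < z" "z < y" "flux v k y - flux v k x = (y - x) * f' z"
      by (rule mean_value_unit_interval[OF f' _ xy(2)]) (use xy \<rho>hat in auto)
    then have "0 < (y - x) * f' z" using xy pos by (intro mult_pos_pos) auto
    then show ?thesis using z by linarith
  qed
  show "flux v k y < flux v k x" if xy: "\<rho>hat \<le> x" "x < y" "y \<le> 1" for x y
  proof -
    obtain z where z: "x < z" "z < y" "flux v k y - flux v k x = (y - x) * f' z"
      by (rule mean_value_unit_interval[OF f' _ xy(2)]) (use xy \<rho>hat in auto)
    then have "(y - x) * f' z < 0" using xy neg by (intro mult_pos_neg) auto
    then show ?thesis using z by linarith
  qed
qed

lemma flux_slope_sign:
  assumes crit: "critical_density v \<rho>hat" and r: "0 < r" "r < 1"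
    and v: "(v has_real_derivative d) (at r within {0..1})"
  shows "r < \<rho>hat \<Longrightarrow> 0 < v r + r * d" and "\<rho>hat < r \<Longrightarrow> v r + r * d < 0"
proof -
  obtain f' where f': "\<forall>r\<in>{0..1}. (flux v 1 has_real_derivative f' r) (at r within {0..1})"
    and signs: "\<forall>r\<in>{0..<\<rho>hat}. 0 < f' r" "\<forall>r\<in>{\<rho>hat<..1}. f' r < 0"
    by (rule critical_density_slopes[OF crit zero_less_one])
  have at: "at r within {0..1} = at r" using r by (rule at_within_Icc_at)
  have "flux v 1 = (\<lambda>r. r * v r)" by (simp add: flux_def fun_eq_iff)
  moreover have "((\<lambda>r. r * v r) has_real_derivative v r + r * d) (at r)"
    using DERIV_mult[OF DERIV_ident v[unfolded at]] by (simp add: mult.commute)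
  ultimately have "(flux v 1 has_real_derivative v r + r * d) (at r)" by simp
  moreover have "(flux v 1 has_real_derivative f' r) (at r)"
    using f'[rule_format, of r] r unfolding at by simp
  ultimately have slope: "f' r = v r + r * d" by (rule DERIV_unique[symmetric])
  show "0 < v r + r * d" if "r < \<rho>hat" using signs(1)[rule_format, of r] r that by (simp add: slope)
  show "v r + r * d < 0" if "\<rho>hat < r" using signs(2)[rule_format, of r] r that by (simp add: slope)
qed

section \<open>The weight as a probability measure\<close>

text \<open>The value \<open>w 0\<close> is arbitrary, so the weight is cut down to the open interval; this changes no
integral and gives a Borel function.\<close>

definition kernel :: "real \<Rightarrow> (real \<Rightarrow> real) \<Rightarrow> real \<Rightarrow> real" where
  "kernel h w y = (if 0 < y \<and> y < h then w y else 0)"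

lemma kernel_measurable:
  assumes "continuous_on {0<..} w"
  shows "kernel h w \<in> borel_measurable borel"
proof -
  have "(\<lambda>y. indicator {0<..<h} y *\<^sub>R w y) \<in> borel_measurable borel"
    using assms by (intro borel_measurable_continuous_on_indicator) (auto elim: continuous_on_subset)
  also have "(\<lambda>y. indicator {0<..<h} y *\<^sub>R w y) = kernel h w"
    by (auto simp: kernel_def indicator_def)
  finally show ?thesis .
qed

lemma kernel_prob_space:
  assumes w_cont: "continuous_on {0<..} w" and w_nonneg: "\<And>x. x \<ge> 0 \<Longrightarrow> w x \<ge> 0"
    and w_int: "(LINT x:{0..h}|lebesgue. w x) = 1" and wh: "w h = 0"
  shows "prob_space (density lborel (\<lambda>y. ennreal (kernel h w y)))"
proof
  note [measurable] = kernel_measurable[OF w_cont, of h]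
  define g where "g x = indicator {0..h} x * w x" for x
  have g_eq: "g x = kernel h w x" if "x \<noteq> 0" for x
    using that wh by (auto simp: g_def kernel_def indicator_def)
  then have g_fun: "g = (\<lambda>x. if x = 0 then g 0 else kernel h w x)"
    by (simp add: fun_eq_iff)
  have g_meas [measurable]: "g \<in> borel_measurable borel"
    by (subst g_fun) measurable
  have AE_eq: "AE x in lborel. g x = kernel h w x"
    using AE_lborel_singleton[of 0] by eventually_elim (rule g_eq)
  have "1 = integral\<^sup>L lebesgue g"
    using w_int by (simp add: set_lebesgue_integral_def g_def[abs_def])
  also have "\<dots> = integral\<^sup>L lborel g" by (rule integral_completion) simp
  also have "\<dots> = integral\<^sup>L lborel (kernel h w)" by (rule integral_cong_AE) (use AE_eq in auto)
  finally have one: "integral\<^sup>L lborel (kernel h w) = 1" by simp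
  then have "integrable lborel (kernel h w)" by (metis not_integrable_integral_eq zero_neq_one)
  then have "(\<integral>\<^sup>+ y. ennreal (kernel h w y) \<partial>lborel) = ennreal 1"
    using one w_nonneg by (subst nn_integral_eq_integral) (auto simp: kernel_def)
  then show "emeasure (density lborel (\<lambda>y. ennreal (kernel h w y)))
      (space (density lborel (\<lambda>y. ennreal (kernel h w y)))) = 1"
    by (simp add: emeasure_density)
qed

text \<open>Passage from the integral against \<open>w\<close> over \<open>[x, x + h]\<close> to the average used above. The
integrands agree except possibly at the two points \<open>0\<close>, where \<open>\<kappa>\<close> is unspecified, and \<open>x\<close>,
where \<open>w 0\<close> enters; at \<open>x + h\<close> the weight vanishes.\<close>

lemma look_ahead_integral:
  fixes f g w :: "real \<Rightarrow> real"
  assumes w_cont: "continuous_on {0<..} w" and w_nonneg: "\<And>x. x \<ge> 0 \<Longrightarrow> w x \<ge> 0"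
    and wh: "w h = 0"
    and f_meas [measurable]: "f \<in> borel_measurable borel" and g_eq: "\<And>y. y \<noteq> 0 \<Longrightarrow> g y = f y"
    and int: "integrable (density lborel (\<lambda>y. ennreal (kernel h w y))) (\<lambda>y. f (x + y))"
  shows "set_integrable lebesgue {x..x + h} (\<lambda>y. g y * w (y - x))"
    and "(LINT y:{x..x + h}|lebesgue. g y * w (y - x))
         = (\<integral>y. f (x + y) \<partial>density lborel (\<lambda>y. ennreal (kernel h w y)))"
proof -
  note [measurable] = kernel_measurable[OF w_cont, of h]
  have k_nonneg: "0 \<le> kernel h w y" for y using w_nonneg by (simp add: kernel_def)
  define G where "G y = kernel h w (y - x) * f y" for y
  have [measurable]: "G \<in> borel_measurable borel" unfolding G_def by measurable
  define H where "H y = indicator {x..x + h} y * (g y * w (y - x))" for y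
  have HG: "H y = G y" if "y \<noteq> 0" "y \<noteq> x" for y
  proof (cases "y = x + h")
    case True
    then show ?thesis by (simp add: H_def G_def kernel_def wh)
  next
    case False
    then show ?thesis using that g_eq[of y] by (auto simp: H_def G_def kernel_def indicator_def)
  qed
  then have H_eq: "H = (\<lambda>y. if y = 0 then H 0 else if y = x then H x else G y)"
    by (simp add: fun_eq_iff)
  have [measurable]: "H \<in> borel_measurable borel"
    by (subst H_eq) measurable
  have AE_eq: "AE y in lborel. H y = G y"
    using AE_lborel_singleton[of 0] AE_lborel_singleton[of x]
    by eventually_elim (rule HG)
  have "integrable lborel (\<lambda>y. kernel h w y * f (x + y))"
    using int k_nonneg by (subst (asm) integrable_density) auto
  then have "integrable lborel (\<lambda>y. G (x + 1 * y))" by (simp add: G_def)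
  then have intG: "integrable lborel G"
    using lborel_integrable_real_affine_iff[of 1 G x] by simp
  then have intH: "integrable lborel H"
    using integrable_cong_AE[of H lborel G] AE_eq by simp
  then have "integrable lebesgue H" by (subst integrable_completion) auto
  then show "set_integrable lebesgue {x..x + h} (\<lambda>y. g y * w (y - x))"
    by (simp add: set_integrable_def H_def[abs_def])
  have "(LINT y:{x..x + h}|lebesgue. g y * w (y - x)) = integral\<^sup>L lebesgue H"
    by (simp add: set_lebesgue_integral_def H_def[abs_def])
  also have "\<dots> = integral\<^sup>L lborel H" by (rule integral_completion) simp
  also have "\<dots> = integral\<^sup>L lborel G" by (rule integral_cong_AE) (use AE_eq in auto)
  also have "\<dots> = (\<integral>y. G (x + 1 * y) \<partial>lborel)"
    using lborel_integral_real_affine[of 1 G x] by simp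
  also have "\<dots> = (\<integral>y. f (x + y) \<partial>density lborel (\<lambda>y. ennreal (kernel h w y)))"
    using k_nonneg by (subst integral_density) (auto simp: G_def)
  finally show "(LINT y:{x..x + h}|lebesgue. g y * w (y - x))
         = (\<integral>y. f (x + y) \<partial>density lborel (\<lambda>y. ennreal (kernel h w y)))" .
qed

section \<open>Infinitely many profiles\<close>

text \<open>If two translates agreed on a half-line, \<open>Q\<close> would be periodic there; along a period it would
keep a value below \<open>\<rho>\<close> and yet tend to \<open>\<rho>\<close>.\<close>

lemma translates_distinct:
  fixes Q :: "real \<Rightarrow> real"
  assumes lim: "(Q \<longlongrightarrow> \<rho>) at_top" and less: "\<And>x. Q x < \<rho>"
    and eq: "\<And>x. 0 \<le> x \<Longrightarrow> Q (x - s) = Q (x - t)"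
  shows "s = t"
proof -
  have *: False if eq: "\<And>x. 0 \<le> x \<Longrightarrow> Q (x - s) = Q (x - t)" and "s < t" for s t
  proof -
    define d where "d = t - s"
    have d: "0 < d" using that by (simp add: d_def)
    have per: "Q (real k * d - t) = Q (- t)" for k
    proof (induction k)
      case (Suc k)
      have "Q (real (Suc k) * d - t) = Q (real k * d - s)" by (simp add: d_def algebra_simps)
      also have "\<dots> = Q (real k * d - t)" using d by (intro eq) auto
      finally show ?case using Suc by simp
    qed simp
    have "\<forall>\<^sub>F x in at_top. Q (- t) < Q x" using order_tendstoD(1)[OF lim less] .
    then obtain N where N: "\<And>x. N \<le> x \<Longrightarrow> Q (- t) < Q x" by (auto simp: eventually_at_top_linorder)
    obtain k where "N + t < real k * d" using reals_Archimedean3[OF d] by blast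
    then show False using N[of "real k * d - t"] per[of k] by simp
  qed
  show ?thesis using *[of s t] *[of t s] eq by (cases s t rule: linorder_cases) auto
qed

theorem theorem3p3:
  fixes h \<kappa>m \<kappa>p \<rho>hat \<rho>m \<rho>p fbar :: real
    and \<kappa> v v' v'' w :: "real \<Rightarrow> real"
  assumes h_pos: "h > 0"
    and \<kappa>m_pos: "\<kappa>m > 0" and \<kappa>p_pos: "\<kappa>p > 0"
    and \<kappa>_neg: "\<And>x. x < 0 \<Longrightarrow> \<kappa> x = \<kappa>m"
    and \<kappa>_pos: "\<And>x. x > 0 \<Longrightarrow> \<kappa> x = \<kappa>p"
    and v_deriv: "\<And>\<rho>. \<rho> \<in> {0..1} \<Longrightarrow> (v has_real_derivative v' \<rho>) (at \<rho> within {0..1})"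
    and v_deriv2: "\<And>\<rho>. \<rho> \<in> {0..1} \<Longrightarrow> (v' has_real_derivative v'' \<rho>) (at \<rho> within {0..1})"
    and v_C2: "continuous_on {0..1} v''"
    and v_0: "v 0 = 1" and v_1: "v 1 = 0"
    and v'_neg: "\<And>\<rho>. \<rho> \<in> {0..1} \<Longrightarrow> v' \<rho> < 0"
    and v''_nonpos: "\<And>\<rho>. \<rho> \<in> {0..1} \<Longrightarrow> v'' \<rho> \<le> 0"
    and w_nonneg: "\<And>x. x \<ge> 0 \<Longrightarrow> w x \<ge> 0"
    and w_cont: "continuous_on {0<..} w"
    and w_bounded: "bounded (w ` {0<..})"
    and w_int: "(LINT x:{0..h}|lebesgue. w x) = 1"
    and w_support: "\<And>x. x \<ge> h \<Longrightarrow> w x = 0"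
    and w_decreasing: "\<And>x. x \<in> {0<..<h} \<Longrightarrow> \<exists>D<0. (w has_real_derivative D) (at x)"
    and \<rho>hat: "critical_density v \<rho>hat"
    and \<kappa>_less: "\<kappa>m < \<kappa>p"
    and \<rho>_order: "0 < \<rho>m" "\<rho>m < \<rho>hat" "\<rho>hat < \<rho>p" "\<rho>p < 1"
    and flux_m: "flux v \<kappa>m \<rho>m = fbar" and flux_p: "flux v \<kappa>p \<rho>p = fbar"
  shows "infinite {P :: real \<Rightarrow> real. stationary_profile h \<kappa> v w fbar P \<and>
                     (P \<longlongrightarrow> \<rho>m) at_bot \<and> (P \<longlongrightarrow> \<rho>p) at_top}"
proof -
  define clamp :: "real \<Rightarrow> real" where "clamp r = max 0 (min 1 r)" for r
  define vc where "vc r = v (clamp r)" for r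
  define M where "M = density lborel (\<lambda>y. ennreal (kernel h w y))"
  have clamp01: "clamp r \<in> {0..1}" for r by (simp add: clamp_def)
  have vc_eq: "vc r = v r" if "0 \<le> r" "r \<le> 1" for r using that by (simp add: vc_def clamp_def)
  have v_less: "v y < v x" if xy: "0 \<le> x" "x < y" "y \<le> 1" for x y
  proof -
    obtain z where z: "x < z" "z < y" "v y - v x = (y - x) * v' z"
      using mean_value_unit_interval[OF v_deriv xy] by blast
    then have "(y - x) * v' z < 0" using that v'_neg[of z] by (intro mult_pos_neg) auto
    then show ?thesis using z by linarith
  qed
  have v_le: "v y \<le> v x" if "0 \<le> x" "x \<le> y" "y \<le> 1" for x y
    using v_less[of x y] that by (cases "x = y") auto
  have wh: "w h = 0" using w_support by simp
  note k_meas [measurable] = kernel_measurable[OF w_cont, of h]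
  interpret prob_space M
    unfolding M_def by (rule kernel_prob_space[OF w_cont w_nonneg w_int wh])
  interpret look_ahead M h vc
  proof
    show "sets M = sets borel" by (simp add: M_def)
    show "AE y in M. 0 < y \<and> y < h"
    proof -
      have "AE y in M. 0 < kernel h w y"
        unfolding M_def by (subst AE_density) simp_all
      then show ?thesis by eventually_elim (auto simp: kernel_def split: if_splits)
    qed
    show "continuous_on UNIV vc"
    proof -
      have "continuous_on {0..1} v" using v_deriv by (rule DERIV_continuous_on)
      moreover have "continuous_on UNIV clamp" unfolding clamp_def by (intro continuous_intros)
      ultimately show ?thesis unfolding vc_def
        by (rule continuous_on_compose2) (use clamp01 in auto)
    qed
    show "antimono vc"
      unfolding vc_def by (intro antimonoI v_le) (auto simp: clamp_def)
    show "0 \<le> vc r" for r using v_le[of "clamp r" 1] clamp01[of r] v_1 by (simp add: vc_def)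
    show "vc r \<le> 1" for r using v_le[of 0 "clamp r"] clamp01[of r] v_0 by (simp add: vc_def)
  qed (rule h_pos)

  obtain C where C: "0 \<le> C" "\<And>r. r \<in> {0..1} \<Longrightarrow> - C \<le> v'' r"
  proof -
    have "bounded (v'' ` {0..1})"
      using v_C2 by (intro compact_imp_bounded compact_continuous_image) auto
    then obtain C where C: "\<forall>r\<in>{0..1}. \<bar>v'' r\<bar> \<le> C" by (auto simp: bounded_iff)
    have "- C \<le> v'' r" if "r \<in> {0..1}" for r using C that by (simp add: abs_le_iff minus_le_iff)
    moreover have "0 \<le> C" using C[rule_format, of 0] abs_ge_zero[of "v'' 0"] by simp
    ultimately show ?thesis using that[of C] by blast
  qed
  note taylor = concave_tangent_parabola[OF v_deriv v_deriv2 C(2) v''_nonpos]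
  have \<rho>m01: "0 < \<rho>m" "\<rho>m < 1" and \<rho>p01: "0 < \<rho>p" "\<rho>p < 1" using \<rho>_order by auto
  have v\<rho>p: "0 < v \<rho>p" using v_less[of \<rho>p 1] \<rho>p01 v_1 by simp
  have stable: "\<rho>m * - v' \<rho>m < v \<rho>m"
    using flux_slope_sign(1)[OF \<rho>hat \<rho>m01 v_deriv \<rho>_order(2)] \<rho>m01 by simp
  have unstable: "v \<rho>p < \<rho>p * - v' \<rho>p"
    using flux_slope_sign(2)[OF \<rho>hat \<rho>p01 v_deriv \<rho>_order(3)] \<rho>p01 by simp

  obtain P0 where P0: "P0 \<in> borel_measurable borel" "mono P0" "\<And>x. 0 \<le> P0 x" "\<And>x. P0 x < \<rho>p"
    "(P0 \<longlongrightarrow> \<rho>p) at_top" "\<And>x. P0 x * avg (\<lambda>z. vc (P0 z)) x = \<rho>p * vc \<rho>p"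
  proof (rule homogeneous_transition[of \<rho>p "- v' \<rho>p" C])
    fix r assume "0 \<le> r" "r \<le> \<rho>p"
    then show "vc r \<le> vc \<rho>p + - v' \<rho>p * (\<rho>p - r)"
      and "vc \<rho>p + - v' \<rho>p * (\<rho>p - r) - C * (\<rho>p - r)\<^sup>2 \<le> vc r"
      using taylor[of r \<rho>p] \<rho>p01 by (simp_all add: vc_eq)
  qed (use \<rho>p01 v\<rho>p unstable C in \<open>auto simp: vc_eq\<close>)

  \<comment> \<open>On \<open>[\<rho>m, \<rho>hat]\<close> the flux on the right road is at least its value at \<open>\<rho>m\<close>, which
    exceeds the flux of the left road there; beyond \<open>\<rho>hat\<close> it decreases to its value at \<open>\<rho>p\<close>.\<close>
  have gap: "\<rho>p * vc \<rho>p < r * vc r" if "\<rho>m \<le> r" "r < \<rho>p" for r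
  proof -
    have "fbar < flux v \<kappa>p r"
    proof (cases "r \<le> \<rho>hat")
      case True
      have "fbar = \<kappa>m * (\<rho>m * v \<rho>m)" using flux_m by (simp add: flux_def)
      also have "\<dots> < \<kappa>p * (\<rho>m * v \<rho>m)"
        using \<kappa>_less \<rho>m01 v_less[of \<rho>m 1] v_1 by (intro mult_strict_right_mono) auto
      also have "\<dots> = flux v \<kappa>p \<rho>m" by (simp add: flux_def)
      also have "\<dots> \<le> flux v \<kappa>p r"
        using flux_unimodal(1)[OF \<rho>hat \<kappa>p_pos, of \<rho>m r] True that \<rho>m01 by (cases "r = \<rho>m") auto
      finally show ?thesis .
    next
      case False
      then show ?thesis
        using flux_unimodal(2)[OF \<rho>hat \<kappa>p_pos, of r \<rho>p] that \<rho>p01 flux_p by simp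
    qed
    then have "\<kappa>p * (\<rho>p * v \<rho>p) < \<kappa>p * (r * v r)" using flux_p by (simp add: flux_def mult.assoc)
    then show ?thesis using \<kappa>p_pos that \<rho>m01 \<rho>p01 by (simp add: vc_eq)
  qed
  obtain x0 where x0: "P0 x0 \<le> \<rho>m"
    using transition_descends[OF P0(2,4,3,1,6) gap] by blast

  \<comment> \<open>For these shifts \<open>x \<le> h\<close> implies \<open>x - s \<le> x0\<close>.\<close>
  have "\<exists>P. stationary_profile h \<kappa> v w fbar P \<and> (P \<longlongrightarrow> \<rho>m) at_bot \<and> (P \<longlongrightarrow> \<rho>p) at_top
      \<and> (\<forall>x\<ge>0. P x = P0 (x - s))" if s: "h - x0 \<le> s" for s
  proof -
    have P0_meas [measurable]: "P0 \<in> borel_measurable borel" by (rule P0(1))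
    have low: "P0 (x - s) \<le> \<rho>m" if "x \<le> h" for x
      using monoD[OF P0(2), of "x - s" x0] x0 that s by simp
    have eq: "\<kappa>p * (P0 (x - s) * avg (\<lambda>z. vc (P0 (z - s))) x) = \<kappa>m * (\<rho>m * vc \<rho>m)" for x
    proof -
      have "avg (\<lambda>z. vc (P0 (z - s))) x = avg (\<lambda>z. vc (P0 z)) (x - s)"
        unfolding avg_def by (simp add: algebra_simps)
      then show ?thesis
        using P0(6)[of "x - s"] flux_m flux_p \<rho>m01 \<rho>p01 by (simp add: flux_def vc_eq mult.assoc)
    qed
    have tangent: "vc r \<le> vc \<rho>m + - v' \<rho>m * (\<rho>m - r)" if "0 \<le> r" "r \<le> \<rho>m" for r
      using taylor(1)[of r \<rho>m] \<rho>m01 that by (simp add: vc_eq)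
    have "v' \<rho>m < 0" using v'_neg[of \<rho>m] \<rho>m01 by simp
    obtain P where P: "P \<in> borel_measurable borel" "\<And>x. 0 \<le> P x" "\<And>x. P x \<le> \<rho>p"
      "\<And>x. P x * avg (\<lambda>z. (if z < 0 then \<kappa>m else \<kappa>p) * vc (P z)) x = \<kappa>m * (\<rho>m * vc \<rho>m)"
      "\<And>x. 0 \<le> x \<Longrightarrow> P x = P0 (x - s)" "(P \<longlongrightarrow> \<rho>m) at_bot"
    proof (rule interface_profile[of \<kappa>m \<kappa>p \<rho>m \<rho>p "- v' \<rho>m" "\<lambda>x. P0 (x - s)", OF \<kappa>m_pos \<kappa>_less])
      show "(\<lambda>x. P0 (x - s)) \<in> borel_measurable borel" by measurable
      show "P0 (x - s) \<le> \<rho>p" for x using P0(4)[of "x - s"] by simp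
    qed (use \<rho>m01 \<rho>p01 \<rho>_order v\<rho>p stable P0(3) low eq tangent \<open>v' \<rho>m < 0\<close> in \<open>simp_all add: vc_eq\<close>)
    have [measurable]: "P \<in> borel_measurable borel" by (rule P(1))
    have P01: "P x \<in> {0..1}" for x using P(2,3)[of x] \<rho>p01 by auto
    have f_meas: "(\<lambda>z. (if z < 0 then \<kappa>m else \<kappa>p) * vc (P z)) \<in> borel_measurable borel"
      by measurable
    have int: "integrable M (\<lambda>y. (if x + y < 0 then \<kappa>m else \<kappa>p) * vc (P (x + y)))" for x
      using \<kappa>m_pos \<kappa>p_pos \<kappa>_less
      by (intro integrable_flow[where \<kappa> = "\<lambda>z. if z < 0 then \<kappa>m else \<kappa>p" and k = \<kappa>p]) auto
    have ae: "\<kappa> y * v (P y) = (if y < 0 then \<kappa>m else \<kappa>p) * vc (P y)" if "y \<noteq> 0" for y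
      using that \<kappa>_neg[of y] \<kappa>_pos[of y] P01[of y] by (auto simp: vc_eq)
    have "stationary_profile h \<kappa> v w fbar P"
      unfolding stationary_profile_def
    proof (intro conjI allI)
      fix x
      note transfer = look_ahead_integral[OF w_cont w_nonneg wh f_meas ae int[unfolded M_def], of x]
      show "P x \<in> {0..1}" by (rule P01)
      show "set_integrable lebesgue {x..x + h} (\<lambda>y. \<kappa> y * v (P y) * w (y - x))"
        by (rule transfer(1))
      show "P x * (LINT y:{x..x + h}|lebesgue. \<kappa> y * v (P y) * w (y - x)) = fbar"
      proof -
        have "(LINT y:{x..x + h}|lebesgue. \<kappa> y * v (P y) * w (y - x))
            = avg (\<lambda>z. (if z < 0 then \<kappa>m else \<kappa>p) * vc (P z)) x"
          unfolding avg_def unfolding M_def by (rule transfer(2))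
        then show ?thesis using P(4)[of x] flux_m \<rho>m01 by (simp add: flux_def vc_eq mult.assoc)
      qed
    qed
    moreover have "(P \<longlongrightarrow> \<rho>p) at_top"
    proof -
      have "filterlim (\<lambda>x. - s + x) at_top at_top"
        by (rule filterlim_tendsto_add_at_top[OF tendsto_const filterlim_ident])
      then have "((\<lambda>x. P0 (- s + x)) \<longlongrightarrow> \<rho>p) at_top" by (rule filterlim_compose[OF P0(5)])
      moreover have "\<forall>\<^sub>F x in at_top. P0 (- s + x) = P x"
        using eventually_ge_at_top[of 0] by eventually_elim (simp add: P(5))
      ultimately show ?thesis by (rule Lim_transform_eventually)
    qed
    ultimately show ?thesis using P(5,6) by blast
  qed
  then obtain family where family: "\<And>s. h - x0 \<le> s \<Longrightarrow>
      stationary_profile h \<kappa> v w fbar (family s) \<and> (family s \<longlongrightarrow> \<rho>m) at_bot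
      \<and> (family s \<longlongrightarrow> \<rho>p) at_top \<and> (\<forall>x\<ge>0. family s x = P0 (x - s))"
    by metis
  have "inj_on family {h - x0..}"
  proof (rule inj_onI)
    fix s t assume st: "s \<in> {h - x0..}" "t \<in> {h - x0..}" "family s = family t"
    show "s = t"
      by (rule translates_distinct[OF P0(5,4)]) (use st family[of s] family[of t] in simp)
  qed
  then have "infinite (family ` {h - x0..})"
    using finite_imageD infinite_Ici by blast
  then show ?thesis
    by (rule infinite_super[rotated]) (use family in auto)
qed

end
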